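(* Let $G=(V,A)$ be a directed graph with $n=|V|$, arc costs $c:A\to\mathbb{Z}_+$, source $s$, sink $t\ne s$, let $\lambda\in\mathbb{Z}_+^{n-1}$, $\varepsilon\ge 0$ and $B=(1+\varepsilon)\cdot f^*_\lambda(s,t)$. The amount of work per path enumerated in Algorithm 2 (described in the context) is in $\mathcal{O}(nT)$, where $T$ denotes the time for solving USPP$(G,\lambda)$.
   Context: $\mathbb{Z}_+$ denotes the nonnegative integers. All paths are simple (no repeated vertices); $\mathcal{P}_{uv}$ is the set of all simple directed $u$-$v$-paths in $G$; $l(P)\le n-1$ is the number of arcs of $P$. For a path $P$, let $c_{(i)}(P)$ be the $i$-th largest arc cost on $P$ for $1\le i\le l(P)$, and $c_{(i)}(P)=0$ for $l(P)<i\le n-1$. For $\lambda\in\mathbb{Z}^{n-1}$ put $f_\lambda(P)=\sum_{i=1}^{n-1}\lambda_i c_{(i)}(P)$. The Universal Shortest Path Problem USPP$(G,\lambda)$ is $\min_{P\in\mathcal{P}_{st}}f_\lambda(P)$; $f^*_\lambda(u,v)$ is the minimum of $f_\lambda$ over $\mathcal{P}_{uv}$. The value $f^*_\lambda(s,t)$ is given as input (so $\mathcal{P}_{st}\ne\emptyset$). Algorithm 2 enumerates the universal near shortest simple paths, i.e. the $P\in\mathcal{P}_{st}$ with $f_\lambda(P)\le B$. $\delta^+_G(u)$ is the set of outgoing arcs of $u$ in $G$; $\mathrm{pred}_P(u)$ is the predecessor of $u$ on path $P$, with $\mathrm{pred}_P(s):=\emptyset$; $G\setminus F$ is $G$ with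 the arcs in $F$ removed. In graph updates, arc sets are added to or removed from the arc set of $G'$, operations being performed from left to right. Algorithm 2. Initialization: compute an optimal path $P$ of USPP$(G,\lambda)$, with vertices $s=v_0,v_1,\dots,v_k=t$. Put $F=\bigcup_{i=0}^{k-2}\big(\delta^+_G(v_i)\setminus\{(v_i,v_{i+1})\}\big)\cup\{(v_{k-1},v_k)\}$ and $G'=G\setminus F$. Set $C[v]=\emptyset$ for all $v\in V$, then $C[v_{k-1}]\leftarrow C[v_{k-1}]\cup\{(v_{k-1},v_k)\}$, and $v\leftarrow v_{k-1}$. The path $P$ counts as the first output path. Then call $\mathrm{UNSSP}(G',C,v,P)$. Procedure $\mathrm{UNSSP}(G',C,v,P)$: 1. If $v=\emptyset$, stop. 2. Let $P'$ be an optimal path of USPP$(G',\lambda)$ from $s$ to $t$, with vertices $s=v'_0,\dots,v'_l=t$; if there is no $s$-$t$-path in $G'$, $P'$ is the empty path $(.)$. (Each such solve costs time $T$.) 3. If $P'=(.)$ or $f_\lambda(P')>B$: set $C[v]\leftarrow\emptyset$; $C[\mathrm{pred}_P(v)]\leftarrow C[\mathrm{pred}_P(v)]\cup\{(\mathrm{pred}_P(v),v)\}$; $G'\leftarrow G'\cup\delta^+_G(v)\cup\delta^+_G(\mathrm{pred}_P(v))\setminus C[\mathrm{pred}_P(v)]$; $v\leftarrow\mathrm{pred}_P(v)$ (operations involving $\mathrm{pred}_P(v)$ other than the last are void when $v=s$); call $\mathrm{UNSSP}(G',C,v,P)$. 4. Otherwise: print $P'$; set $C[v'_{l-1}]\leftarrow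 C[v'_{l-1}]\cup\{(v'_{l-1},v'_l)\}$; $F\leftarrow\bigcup_{i=0}^{l-2}\big(\delta^+_G(v'_i)\setminus\{(v'_i,v'_{i+1})\}\big)\cup\{(v'_{l-1},v'_l)\}$; $G'\leftarrow G'\setminus F$; $v\leftarrow v'_{l-1}$; call $\mathrm{UNSSP}(G',C,v,P')$. The amount of work per path enumerated is the running time spent before the first path is output and between any two consecutively output paths. *)

theory Defs
  imports Complex_Main "Graph_Theory.Pair_Digraph"
begin

section \<open>Universal shortest paths\<close>

text \<open>
  A digraph is a \<open>pair_pre_digraph\<close>, so arcs are pairs of vertices and there are no parallel
  arcs (loops are allowed). A simple path is an \<open>apath\<close>, given by the list of its arcs.
  A vector \<open>\<lambda> \<in> \<int>\<^sub>+\<^bsup>n-1\<^esup>\<close> is a function of which only the values at \<open>1, \<dots>, n-1\<close> are used.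
\<close>

type_synonym 'v dipath = "('v \<times> 'v) list"

definition simple_paths :: "'v pair_pre_digraph \<Rightarrow> 'v \<Rightarrow> 'v \<Rightarrow> 'v dipath set" where
  "simple_paths G u v = {p. pre_digraph.apath (with_proj G) u p v}"

definition nth_largest_cost :: "('v \<times> 'v \<Rightarrow> nat) \<Rightarrow> 'v dipath \<Rightarrow> nat \<Rightarrow> nat" where
  "nth_largest_cost c p i =
     (if 1 \<le> i \<and> i \<le> length p then rev (sort (map c p)) ! (i - 1) else 0)"

definition universal_cost ::
  "'v pair_pre_digraph \<Rightarrow> ('v \<times> 'v \<Rightarrow> nat) \<Rightarrow> (nat \<Rightarrow> nat) \<Rightarrow> 'v dipath \<Rightarrow> nat" where
  "universal_cost G c lam p = (\<Sum>i = 1..card (pverts G) - 1. lam i * nth_largest_cost c p i)"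

definition optimal_path ::
  "'v pair_pre_digraph \<Rightarrow> ('v \<times> 'v \<Rightarrow> nat) \<Rightarrow> (nat \<Rightarrow> nat) \<Rightarrow> 'v \<Rightarrow> 'v \<Rightarrow> 'v dipath \<Rightarrow> bool" where
  "optimal_path G c lam u v p \<longleftrightarrow>
     is_arg_min (universal_cost G c lam) (\<lambda>q. q \<in> simple_paths G u v) p"

definition optimal_value ::
  "'v pair_pre_digraph \<Rightarrow> ('v \<times> 'v \<Rightarrow> nat) \<Rightarrow> (nat \<Rightarrow> nat) \<Rightarrow> 'v \<Rightarrow> 'v \<Rightarrow> nat" where
  "optimal_value G c lam u v = Min (universal_cost G c lam ` simple_paths G u v)"


section \<open>Enumeration of the universal near shortest simple paths\<close>

definition arcs_from :: "'v pair_pre_digraph \<Rightarrow> 'v \<Rightarrow> ('v \<times> 'v) set" where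
  "arcs_from G u = out_arcs (with_proj G) u"

definition add_arcs :: "'v pair_pre_digraph \<Rightarrow> ('v \<times> 'v) set \<Rightarrow> 'v pair_pre_digraph" where
  "add_arcs H F = H\<lparr>parcs := parcs H \<union> F\<rparr>"

definition remove_arcs :: "'v pair_pre_digraph \<Rightarrow> ('v \<times> 'v) set \<Rightarrow> 'v pair_pre_digraph" where
  "remove_arcs H F = H\<lparr>parcs := parcs H - F\<rparr>"

text \<open>\<open>None\<close> encodes \<open>\<emptyset>\<close>; it is the value at the source of a simple path.\<close>

definition pred_on :: "'v dipath \<Rightarrow> 'v \<Rightarrow> 'v option" where
  "pred_on p v = (if \<exists>u. (u, v) \<in> set p then Some (THE u. (u, v) \<in> set p) else None)"

text \<open>
  The set \<open>F\<close> of a path with arcs \<open>(v\<^sub>0,v\<^sub>1), \<dots>, (v\<^sub>l\<^sub>-\<^sub>1,v\<^sub>l)\<close>: the arcs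
  \<open>(v\<^sub>i,v\<^sub>i\<^sub>+\<^sub>1)\<close>, \<open>i \<le> l - 2\<close>, are those in \<open>butlast p\<close>.
\<close>

definition blocked_arcs :: "'v pair_pre_digraph \<Rightarrow> 'v dipath \<Rightarrow> ('v \<times> 'v) set" where
  "blocked_arcs G p = (\<Union>a \<in> set (butlast p). arcs_from G (fst a) - {a}) \<union> {last p}"

text \<open>
  Cost model. Time is counted in elementary operations: a test, an assignment, a predecessor
  look-up, the insertion of a single arc into a set, a procedure call, and the printing of one arc
  (or of the end marker of a path) cost one unit each. A set is modified in place; adding a set of
  arcs to another set, removing it from another set, or emptying it costs its cardinality.
  In particular, \<open>G'\<close> is kept as a marking of the arcs of \<open>G\<close>, all arcs being marked at
  the start.

  A solve of USPP delivers an optimal path together with its value, so the test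
  \<open>f(P') > B\<close> is elementary.
\<close>

text \<open>Building \<open>F\<close> by a scan of the sets \<open>\<delta>\<^sup>+(v\<^sub>i)\<close>, and then removing it from \<open>G'\<close>.\<close>

definition block_time :: "'v pair_pre_digraph \<Rightarrow> 'v dipath \<Rightarrow> nat" where
  "block_time G p =
     (\<Sum>a\<leftarrow>butlast p. card (arcs_from G (fst a))) + 1 + card (blocked_arcs G p)"

record 'v unssp_state =
  cur_graph :: "'v pair_pre_digraph"                \<comment> \<open>\<open>G'\<close>\<close>
  cut_arcs :: "'v \<Rightarrow> ('v \<times> 'v) set"                  \<comment> \<open>\<open>C\<close>\<close>
  cur_vertex :: "'v option"                         \<comment> \<open>\<open>v\<close>\<close>
  last_path :: "'v dipath"                          \<comment> \<open>\<open>P\<close>\<close>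
  clock :: nat                                      \<comment> \<open>time elapsed since the start\<close>
  outputs :: "('v dipath \<times> nat) list"               \<comment> \<open>output paths and when they were output\<close>

context
  fixes G :: "'v pair_pre_digraph" and c :: "'v \<times> 'v \<Rightarrow> nat" and lam :: "nat \<Rightarrow> nat"
    and s t :: 'v and B :: real and T :: nat
begin

text \<open>
  \<open>uspp_solve H r \<tau>\<close>: a solve of USPP on \<open>H\<close> may return \<open>r\<close> after time \<open>\<tau>\<close>, where
  \<open>None\<close> stands for the empty path \<open>(.)\<close>. Ties between optimal paths may be broken
  arbitrarily, and differently in different solves. Every solve takes time at most \<open>T\<close>. It writes
  its result, so it takes at least one unit for each arc of the path and one for the value.
\<close>

definition uspp_solve :: "'v pair_pre_digraph \<Rightarrow> 'v dipath option \<Rightarrow> nat \<Rightarrow> bool" where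
  "uspp_solve H r \<tau> \<longleftrightarrow> \<tau> \<le> T \<and>
     (case r of
        None \<Rightarrow> simple_paths H s t = {} \<and> 1 \<le> \<tau>
      | Some p \<Rightarrow> optimal_path H c lam s t p \<and> length p + 1 \<le> \<tau>)"

definition rejected :: "'v dipath option \<Rightarrow> bool" where
  "rejected r \<longleftrightarrow> (case r of None \<Rightarrow> True | Some p \<Rightarrow> real (universal_cost G c lam p) > B)"

text \<open>
  The state of the first call of UNSSP. The summand \<open>card (pverts G)\<close> is for setting all
  \<open>C[v]\<close> to \<open>\<emptyset>\<close>, the summand 2 for the insertion into \<open>C[v\<^sub>k\<^sub>-\<^sub>1]\<close> and the assignment
  to \<open>v\<close>, and \<open>length P + 1\<close> for printing \<open>P\<close>.
\<close>

inductive unssp_init :: "'v unssp_state \<Rightarrow> bool" where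
  "\<lbrakk>uspp_solve G (Some P) \<tau>;
    \<theta> = \<tau> + card (pverts G) + block_time G P + 2 + (length P + 1)\<rbrakk> \<Longrightarrow>
   unssp_init
     \<lparr>cur_graph = remove_arcs G (blocked_arcs G P),
      cut_arcs = (\<lambda>v. {})(fst (last P) := {last P}),
      cur_vertex = Some (fst (last P)),
      last_path = P,
      clock = \<theta>,
      outputs = [(P, \<theta>)]\<rparr>"

text \<open>
  One call of UNSSP up to and including the recursive call; there is no transition if
  \<open>v = \<emptyset>\<close>. In each rule \<open>\<tau> + 3\<close> accounts for the solve, the test \<open>v = \<emptyset>\<close>, the test of
  the result and the recursive call. The rules \<open>backtrack\<close> and \<open>backtrack_source\<close>
  are step 3 for \<open>v \<noteq> s\<close> and \<open>v = s\<close>. In the rule \<open>output_path\<close>, the output time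
  \<open>\<theta>\<close> precedes the updates that follow the printing.
\<close>

inductive unssp_step :: "'v unssp_state \<Rightarrow> 'v unssp_state \<Rightarrow> bool" where
  backtrack:
    "\<lbrakk>cur_vertex \<sigma> = Some v; uspp_solve (cur_graph \<sigma>) r \<tau>; rejected r;
      pred_on (last_path \<sigma>) v = Some u;
      C1 = (cut_arcs \<sigma>)(v := {});
      C2 = C1(u := C1 u \<union> {(u, v)});
      ops = card (cut_arcs \<sigma> v)
          + 1 + 1                                                     \<comment> \<open>predecessor, insertion\<close>
          + card (arcs_from G v) + card (arcs_from G u) + card (C2 u) \<comment> \<open>update of \<open>G'\<close>\<close>
          + 1                                                         \<comment> \<open>assignment to \<open>v\<close>\<close>\<rbrakk> \<Longrightarrow>
     unssp_step \<sigma>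
       (\<sigma>\<lparr>cur_graph := remove_arcs
                        (add_arcs (add_arcs (cur_graph \<sigma>) (arcs_from G v)) (arcs_from G u)) (C2 u),
          cut_arcs := C2,
          cur_vertex := Some u,
          clock := clock \<sigma> + (\<tau> + 3) + ops\<rparr>)"
| backtrack_source:
    "\<lbrakk>cur_vertex \<sigma> = Some v; uspp_solve (cur_graph \<sigma>) r \<tau>; rejected r;
      pred_on (last_path \<sigma>) v = None;
      ops = card (cut_arcs \<sigma> v) + 1 + card (arcs_from G v) + 1\<rbrakk> \<Longrightarrow>
     unssp_step \<sigma>
       (\<sigma>\<lparr>cur_graph := add_arcs (cur_graph \<sigma>) (arcs_from G v),
          cut_arcs := (cut_arcs \<sigma>)(v := {}),
          cur_vertex := None,
          clock := clock \<sigma> + (\<tau> + 3) + ops\<rparr>)"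
| output_path:
    "\<lbrakk>cur_vertex \<sigma> = Some v; uspp_solve (cur_graph \<sigma>) (Some P') \<tau>; \<not> rejected (Some P');
      w = fst (last P');
      \<theta> = clock \<sigma> + (\<tau> + 2) + (length P' + 1)\<rbrakk> \<Longrightarrow>
     unssp_step \<sigma>
       (\<sigma>\<lparr>cur_graph := remove_arcs (cur_graph \<sigma>) (blocked_arcs G P'),
          cut_arcs := (cut_arcs \<sigma>)(w := cut_arcs \<sigma> w \<union> {last P'}),
          cur_vertex := Some w,
          last_path := P',
          clock := \<theta> + 1 + block_time G P' + 1 + 1,
          outputs := outputs \<sigma> @ [(P', \<theta>)]\<rparr>)"

definition unssp_reachable :: "'v unssp_state \<Rightarrow> bool" where
  "unssp_reachable \<sigma> \<longleftrightarrow> (\<exists>\<sigma>\<^sub>0. unssp_init \<sigma>\<^sub>0 \<and> unssp_step\<^sup>*\<^sup>* \<sigma>\<^sub>0 \<sigma>)"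

end

text \<open>
  For output times \<open>\<theta>\<^sub>1 \<le> \<theta>\<^sub>2 \<le> \<dots> \<le> \<theta>\<^sub>k\<close> this is
  \<open>[\<theta>\<^sub>1, \<theta>\<^sub>2 - \<theta>\<^sub>1, \<dots>, \<theta>\<^sub>k - \<theta>\<^sub>k\<^sub>-\<^sub>1]\<close>.
\<close>

definition work_per_path :: "'v unssp_state \<Rightarrow> nat list" where
  "work_per_path \<sigma> = (let ts = map snd (outputs \<sigma>) in map2 (-) ts (0 # ts))"

end

(* Between two outputs the algorithm only walks back along the last output path P. There are at
   most length P backtracking steps, and each costs one solve plus O(n) elementary operations
   because every C[v] stays inside the outgoing arcs of v. The walk therefore takes
   O(length P * (T + n)). Since P is simple, length P < n; since the solve that returned P had to
   write it, length P < T; hence both summands are O(n T). *)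
theory Submission
  imports Defs
begin

section \<open>Out-degrees and the cost of building and removing \<open>F\<close>\<close>

lemma (in pair_fin_digraph) finite_arcs_from: "finite (arcs_from G u)"
  unfolding arcs_from_def by (rule finite_subset[OF _ finite_arcs]) auto

lemma (in pair_fin_digraph) card_arcs_from_le: "card (arcs_from G u) \<le> card (pverts G)"
proof -
  have "arcs_from G u \<subseteq> Pair u ` pverts G"
    using wellformed by (fastforce simp: arcs_from_def)
  then have "card (arcs_from G u) \<le> card (Pair u ` pverts G)"
    using finite_verts by (intro card_mono) auto
  also have "\<dots> \<le> card (pverts G)"
    using finite_verts by (intro card_image_le) auto
  finally show ?thesis .
qed

text \<open>Each out-degree is at most the number of vertices. This bounds the scan that builds
  \<open>F\<close> and, separately, the cardinality of \<open>F\<close> that its removal costs;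
  hence the factor 2. The summand 2 is the unit in \<open>block_time\<close> plus the arc
  \<open>last p\<close>.\<close>

lemma (in pair_fin_digraph) block_time_le:
  assumes "p \<noteq> []"
  shows "block_time G p \<le> 2 * (length p * card (pverts G)) + 2"
proof -
  let ?n = "card (pverts G)"
  let ?S = "\<Sum>a\<leftarrow>butlast p. card (arcs_from G (fst a))"
  have S: "?S \<le> length p * ?n"
  proof -
    have "?S \<le> (\<Sum>a\<leftarrow>butlast p. ?n)"
      by (intro sum_list_mono card_arcs_from_le)
    also have "\<dots> \<le> length p * ?n"
      by (simp add: sum_list_triv)
    finally show ?thesis .
  qed
  have "card (\<Union>a \<in> set (butlast p). arcs_from G (fst a) - {a})
      \<le> (\<Sum>a \<in> set (butlast p). card (arcs_from G (fst a) - {a}))"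
    by (intro card_UN_le) simp
  also have "\<dots> \<le> (\<Sum>a \<in> set (butlast p). ?n)"
    by (intro sum_mono order_trans[OF card_mono card_arcs_from_le] finite_arcs_from) auto
  also have "\<dots> = card (set (butlast p)) * ?n"
    by simp
  also have "\<dots> \<le> length p * ?n"
    using card_length[of "butlast p"] by (intro mult_right_mono) auto
  finally have "card (blocked_arcs G p) \<le> length p * ?n + 1"
    unfolding blocked_arcs_def
    using card_Un_le[of "\<Union>a \<in> set (butlast p). arcs_from G (fst a) - {a}" "{last p}"] by simp
  with S show ?thesis
    unfolding block_time_def by linarith
qed

section \<open>Simple paths in subgraphs, their length and their predecessors\<close>

text \<open>Solves run on the current graph \<open>G'\<close>, whereas all bounds refer to
  \<open>G\<close>; this carries the returned path over.\<close>

lemma simple_paths_mono: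
  assumes "pverts H = pverts G" "parcs H \<subseteq> parcs G"
  shows "simple_paths H u v \<subseteq> simple_paths G u v"
proof -
  \<comment> \<open>Under \<open>with_proj\<close> tail and head are \<open>fst\<close> and
    \<open>snd\<close> in every graph, so only membership of vertices and arcs depends on the
    graph.\<close>
  have cas: "pre_digraph.cas (with_proj H) u p v = pre_digraph.cas (with_proj G) u p v" for u p
    by (induction p arbitrary: u) (auto simp: pre_digraph.cas.simps)
  have verts: "pre_digraph.awalk_verts (with_proj H) u p = pre_digraph.awalk_verts (with_proj G) u p"
    for u p
    by (induction p arbitrary: u) (auto simp: pre_digraph.awalk_verts.simps)
  show ?thesis
    using assms
    by (auto simp: simple_paths_def pre_digraph.apath_def pre_digraph.awalk_def cas verts)
qed

lemma simple_paths_nonempty: "u \<noteq> v \<Longrightarrow> p \<in> simple_paths G u v \<Longrightarrow> p \<noteq> []"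
  by (auto simp: simple_paths_def pre_digraph.apath_def pre_digraph.awalk_def pre_digraph.cas.simps)

lemma simple_paths_arcs: "p \<in> simple_paths G u v \<Longrightarrow> set p \<subseteq> parcs G"
  by (auto simp: simple_paths_def pre_digraph.apath_def pre_digraph.awalk_def)

lemma (in pair_fin_digraph) simple_paths_length:
  assumes "p \<in> simple_paths G u v"
  shows "length p \<le> card (pverts G)"
proof -
  have p: "apath u p v"
    using assms by (simp add: simple_paths_def)
  then have "distinct (awalk_verts u p)" "set (awalk_verts u p) \<subseteq> pverts G"
    by (auto simp: apath_def)
  then have "length (awalk_verts u p) \<le> card (pverts G)"
    using finite_verts by (metis card_mono distinct_card)
  then show ?thesis
    by (simp add: length_awalk_verts)
qed

lemma nth_arcs_of_path:
  assumes "pre_digraph.cas (with_proj G) u p v" "Suc i < length p"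
  shows "snd (p ! i) = fst (p ! Suc i)"
  using assms
proof (induction p arbitrary: u i)
  case (Cons a p)
  then show ?case
    by (cases p; cases i) (auto simp: pre_digraph.cas.simps)
qed simp

lemma awalk_verts_with_proj:
  assumes "pre_digraph.cas (with_proj G) u p v"
  shows "pre_digraph.awalk_verts (with_proj G) u p = u # map snd p"
  using assms
proof (induction p arbitrary: u)
  case (Cons a p)
  then show ?case
    by (auto simp: pre_digraph.cas.simps pre_digraph.awalk_verts.simps)
qed (simp add: pre_digraph.awalk_verts.simps)

text \<open>Since the vertices are distinct, at most one arc of \<open>p\<close> enters any vertex
  and none enters \<open>s\<close>. A predecessor step therefore lowers the arc index by exactly
  one. The arc itself is also recorded, because backtracking inserts it into
  \<open>C[u]\<close>.\<close>

lemma pred_on_nth: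
  assumes p: "p \<in> simple_paths G s t" and k: "k < length p"
    and pred: "pred_on p (fst (p ! k)) = Some u"
  obtains j where "k = Suc j" "u = fst (p ! j)" "(u, fst (p ! k)) \<in> set p"
proof -
  let ?v = "fst (p ! k)"
  have cas: "pre_digraph.cas (with_proj G) s p t"
    and dist: "distinct (s # map snd p)"
    using p awalk_verts_with_proj[of G s p t]
    by (auto simp: simple_paths_def pre_digraph.apath_def pre_digraph.awalk_def)
  have uniq: "a = b" if "(a, ?v) \<in> set p" "(b, ?v) \<in> set p" for a b
    using dist that inj_onD[of snd "set p" "(a, ?v)" "(b, ?v)"] by (auto simp: distinct_map)
  obtain u' where u': "(u', ?v) \<in> set p"
    using pred by (auto simp: pred_on_def split: if_splits)
  then have "(THE u. (u, ?v) \<in> set p) = u'"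
    using uniq by blast
  then have uu: "u = u'"
    using pred u' by (auto simp: pred_on_def split: if_splits)
  obtain i where i: "i < length p" "p ! i = (u, ?v)"
    using u' uu by (auto simp: in_set_conv_nth)
  have "k \<noteq> 0"
  proof
    assume "k = 0"
    then have "?v = s"
      using cas k by (cases p) (auto simp: pre_digraph.cas.simps)
    then show False
      using dist u' by force
  qed
  then obtain j where j: "k = Suc j"
    by (cases k) auto
  have "snd (p ! j) = ?v"
    using nth_arcs_of_path[OF cas, of j] k j by simp
  \<comment> \<open>The arc before index \<open>k\<close> and the arc found by
    \<open>pred_on\<close> share their head, and heads do not repeat.\<close>
  then have "map snd p ! j = map snd p ! i"
    using i k j by simp
  then have "i = j"
    using dist i k j nth_eq_iff_index_eq[of "map snd p" j i] by simp
  then show thesis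
    using that j i u' uu by auto
qed

section \<open>Gaps between output times and the invariant of the recursion\<close>

text \<open>The starting time \<open>a\<close> is 0 in the application but changes along the
  induction.\<close>

lemma map2_diff_snoc:
  "map2 (-) (xs @ [x]) (a # xs @ [x]) = map2 (-) xs (a # xs) @ [x - last (a # xs)]" for x :: nat
  by (induction xs arbitrary: a) auto

text \<open>An output only appends one gap, so bounds on earlier gaps persist. With an output
  already present, the gap starts at the last output time and not at the initial 0.\<close>

lemma work_per_path_output:
  assumes "outputs \<sigma>' = outputs \<sigma> @ [(P, \<theta>)]" "outputs \<sigma> \<noteq> []"
  shows "work_per_path \<sigma>' = work_per_path \<sigma> @ [\<theta> - snd (last (outputs \<sigma>))]"
  using assms map2_diff_snoc[of "map snd (outputs \<sigma>)" \<theta> 0]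
  by (simp add: work_per_path_def Let_def last_map)

text \<open>\<open>j\<close> counts the backtracking steps made since the last output.\<close>

definition unssp_inv :: "'v pair_pre_digraph \<Rightarrow> 'v \<Rightarrow> 'v \<Rightarrow> nat \<Rightarrow> 'v unssp_state \<Rightarrow> bool" where
  "unssp_inv G s t T \<sigma> \<longleftrightarrow>
     pverts (cur_graph \<sigma>) = pverts G \<and> parcs (cur_graph \<sigma>) \<subseteq> parcs G
   \<and> (\<forall>x. cut_arcs \<sigma> x \<subseteq> arcs_from G x)
   \<and> last_path \<sigma> \<in> simple_paths G s t \<and> length (last_path \<sigma>) + 1 \<le> T
   \<and> outputs \<sigma> \<noteq> []
   \<and> (\<forall>w \<in> set (work_per_path \<sigma>). w \<le> 23 * (card (pverts G) * T))
   \<and> (\<exists>j \<le> length (last_path \<sigma>).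
        clock \<sigma> \<le> snd (last (outputs \<sigma>)) + 7 * (card (pverts G) * T)
                  + j * (T + 6 + 4 * card (pverts G))
      \<and> (\<forall>v. cur_vertex \<sigma> = Some v \<longrightarrow>
            j < length (last_path \<sigma>) \<and> v = fst (last_path \<sigma> ! (length (last_path \<sigma>) - Suc j))))"

lemma uspp_solve_SomeD:
  assumes "uspp_solve c lam s t T H (Some p) \<tau>"
  shows "p \<in> simple_paths H s t" "length p + 1 \<le> \<tau>" "\<tau> \<le> T"
  using assms by (auto simp: uspp_solve_def optimal_path_def is_arg_min_def)

lemma uspp_solve_time: "uspp_solve c lam s t T H r \<tau> \<Longrightarrow> \<tau> \<le> T"
  by (simp add: uspp_solve_def)

lemma last_eq_arc_from: "p \<noteq> [] \<Longrightarrow> set p \<subseteq> parcs G \<Longrightarrow> last p \<in> arcs_from G (fst (last p))"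
  using last_in_set[of p] by (auto simp: arcs_from_def)

section \<open>Constants of the running time and preservation of the invariant\<close>

context pair_fin_digraph
begin

lemma card_cut_arcs_le:
  assumes "unssp_inv G s t T \<sigma>"
  shows "card (cut_arcs \<sigma> x) \<le> card (pverts G)"
proof -
  have "cut_arcs \<sigma> x \<subseteq> arcs_from G x"
    using assms by (simp add: unssp_inv_def)
  then have "card (cut_arcs \<sigma> x) \<le> card (arcs_from G x)"
    by (intro card_mono finite_arcs_from)
  with card_arcs_from_le show ?thesis
    by (rule order_trans[rotated])
qed

lemma block_time_le_mult:
  assumes "p \<noteq> []" "length p + 1 \<le> T" "1 \<le> card (pverts G)"
  shows "block_time G p + 3 \<le> 7 * (card (pverts G) * T)"
proof -
  have "length p * card (pverts G) \<le> card (pverts G) * T"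
    using assms(2) by (simp add: mult.commute)
  \<comment> \<open>The additive constant 2 + 3 = 5 is absorbed as well, which gives the factor 2 +
    5 = 7.\<close>
  moreover have "1 * 1 \<le> card (pverts G) * T"
    using assms by (intro mult_le_mono) auto
  ultimately show ?thesis
    using block_time_le[OF assms(1)] by linarith
qed

lemma unssp_inv_init:
  assumes "unssp_init G c lam s t T \<sigma>" "s \<noteq> t" "s \<in> pverts G"
  shows "unssp_inv G s t T \<sigma>"
  using assms(1)
proof cases
  case (1 P \<tau> \<theta>)
  let ?n = "card (pverts G)"
  note P = uspp_solve_SomeD[OF 1(2)]
  have ne: "P \<noteq> []"
    using P(1) assms(2) by (rule simple_paths_nonempty[rotated])
  have arcs: "set P \<subseteq> parcs G"
    using P(1) by (rule simple_paths_arcs)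
  have n: "1 \<le> ?n"
    using assms(3) finite_verts by (auto simp: Suc_le_eq card_gt_0_iff)
  have len: "length P + 1 \<le> T"
    using P by linarith
  have "?n * 1 \<le> ?n * T" "1 * T \<le> ?n * T"
    using n len by (intro mult_le_mono; simp)+
  then have "\<theta> \<le> 23 * (?n * T)"
    using block_time_le_mult[OF ne len n] 1(3) P len by linarith
  moreover have "last P = P ! (length P - Suc 0)"
    using ne by (simp add: last_conv_nth)
  ultimately show ?thesis
    using 1 P(1) len ne last_eq_arc_from[OF ne arcs]
    by (auto simp: unssp_inv_def remove_arcs_def work_per_path_def intro!: exI[of _ 0])
qed

lemma unssp_inv_step:
  assumes "unssp_step G c lam s t B T \<sigma> \<sigma>'" "unssp_inv G s t T \<sigma>" "s \<noteq> t" "s \<in> pverts G"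
  shows "unssp_inv G s t T \<sigma>'"
proof -
  let ?n = "card (pverts G)" and ?P = "last_path \<sigma>"
  let ?X = "T + 6 + 4 * ?n" and ?t = "snd (last (outputs \<sigma>))"
  note inv = assms(2)[unfolded unssp_inv_def]
  have cut: "cut_arcs \<sigma> x \<subseteq> arcs_from G x" for x
    using inv by blast
  have n: "1 \<le> ?n"
    using assms(4) finite_verts by (auto simp: Suc_le_eq card_gt_0_iff)
  have path: "?P \<in> simple_paths G s t" and lenT: "length ?P + 1 \<le> T"
    using inv by auto
  obtain j where j: "j \<le> length ?P" "clock \<sigma> \<le> ?t + 7 * (?n * T) + j * ?X"
    "\<And>v. cur_vertex \<sigma> = Some v \<Longrightarrow>
      j < length ?P \<and> v = fst (?P ! (length ?P - Suc j))"
    using inv by blast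
  show ?thesis
    using assms(1)
  proof cases
    case (backtrack v r \<tau> u C1 C2 ops)
    have v: "j < length ?P" "v = fst (?P ! (length ?P - Suc j))"
      using j(3)[OF backtrack(2)] by auto
    obtain i where i: "length ?P - Suc j = Suc i" "u = fst (?P ! i)" "(u, v) \<in> set ?P"
    proof (rule pred_on_nth[OF path])
      show "length ?P - Suc j < length ?P"
        using v(1) by linarith
      show "pred_on ?P (fst (?P ! (length ?P - Suc j))) = Some u"
        using backtrack(5) unfolding v(2) .
    qed (use that v(2) in blast)
    have i': "Suc j < length ?P" "i = length ?P - Suc (Suc j)"
      using i(1) v(1) by auto
    have "(u, v) \<in> arcs_from G u"
      using i(3) simple_paths_arcs[OF path] by (auto simp: arcs_from_def)
    \<comment> \<open>The inserted arc lies on the last path, hence in \<open>G\<close>; this keeps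
      every \<open>C[x]\<close> among the arcs leaving \<open>x\<close>.\<close>
    then have C2: "C2 x \<subseteq> arcs_from G x" for x
      using cut backtrack(6,7) by auto
    have "card (C2 u) \<le> ?n"
      using card_mono[OF finite_arcs_from C2[of u]] card_arcs_from_le[of u] by linarith
    \<comment> \<open>The four cardinalities in \<open>ops\<close> give 4n, its three single units
      and the 3 of the call give 6, and the solve gives \<open>T\<close>.\<close>
    then have "\<tau> + 3 + ops \<le> ?X"
      using backtrack(8) card_cut_arcs_le[OF assms(2), of v] card_arcs_from_le[of v]
        card_arcs_from_le[of u] uspp_solve_time[OF backtrack(3)] by linarith
    then have "clock \<sigma> + (\<tau> + 3) + ops \<le> ?t + 7 * (?n * T) + Suc j * ?X"
      using j(2) by simp
    then show ?thesis
      using inv backtrack(1) C2 i' i(2)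
      by (auto simp: unssp_inv_def remove_arcs_def add_arcs_def arcs_from_def work_per_path_def
          intro!: exI[of _ "Suc j"])
  next
    case (backtrack_source v r \<tau> ops)
    have v: "j < length ?P"
      using j(3)[OF backtrack_source(2)] by auto
    have "\<tau> + 3 + ops \<le> ?X"
      using backtrack_source(6) card_cut_arcs_le[OF assms(2), of v] card_arcs_from_le[of v]
        uspp_solve_time[OF backtrack_source(3)] by linarith
    then have "clock \<sigma> + (\<tau> + 3) + ops \<le> ?t + 7 * (?n * T) + Suc j * ?X"
      using j(2) by simp
    \<comment> \<open>The counter may now reach \<open>length ?P\<close>: the strict bound is
      demanded only while the current vertex is not \<open>None\<close>.\<close>
    then show ?thesis
      using inv backtrack_source(1) v
      by (auto simp: unssp_inv_def add_arcs_def arcs_from_def work_per_path_def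
          intro!: exI[of _ "Suc j"])
  next
    case (output_path v P' \<tau> w \<theta>)
    note P' = uspp_solve_SomeD[OF output_path(3)]
    have path': "P' \<in> simple_paths G s t"
      using P'(1) simple_paths_mono[of "cur_graph \<sigma>" G] inv by blast
    have ne: "P' \<noteq> []"
      using path' assms(3) by (rule simple_paths_nonempty[rotated])
    have len: "length P' + 1 \<le> T"
      using P' by linarith
    have last: "last P' \<in> arcs_from G w"
      using last_eq_arc_from[OF ne simple_paths_arcs[OF path']] output_path(5) by simp
    have "\<theta> - ?t \<le> 23 * (?n * T)"
    proof -
      \<comment> \<open>The counter \<open>j\<close> is bounded in two ways: by n where it
        multiplies \<open>T\<close>, and by \<open>T\<close> where it multiplies n. This avoids a
        term quadratic in n.\<close>
      have "j * T \<le> ?n * T" "j * ?n \<le> T * ?n"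
        using j(1) simple_paths_length[OF path] lenT by (intro mult_le_mono; linarith)+
      moreover have "j * ?X = j * T + 6 * j + 4 * (j * ?n)"
        by (simp add: algebra_simps)
      moreover have "1 * T \<le> ?n * T"
        using n by (intro mult_le_mono) auto
      moreover have "T * ?n = ?n * T"
        by simp
      \<comment> \<open>In units of nT: 7 for the updates after the previous output, 1 + 4 + 6 for
        the backtracking, and 2 T + 2 time units for the final solve and the printing; 23 leaves
        slack.\<close>
      ultimately show ?thesis
        using j(1,2) lenT len P' output_path(6) by linarith
    qed
    moreover have "work_per_path \<sigma>' = work_per_path \<sigma> @ [\<theta> - ?t]"
      using inv output_path(1) by (intro work_per_path_output[of _ _ P']) auto
    ultimately have work: "\<forall>w \<in> set (work_per_path \<sigma>'). w \<le> 23 * (?n * T)"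
      using inv by auto
    have "last P' = P' ! (length P' - Suc 0)"
      using ne by (simp add: last_conv_nth)
    \<comment> \<open>The counter restarts at 0, and the updates after printing fit into the summand
      7nT of the invariant.\<close>
    moreover have "\<theta> + 1 + block_time G P' + 1 + 1 \<le> \<theta> + 7 * (?n * T)"
      using block_time_le_mult[OF ne len n] by linarith
    moreover have "parcs (remove_arcs (cur_graph \<sigma>) (blocked_arcs G P')) \<subseteq> parcs G"
      using inv by (auto simp: remove_arcs_def)
    moreover have "pverts (remove_arcs (cur_graph \<sigma>) (blocked_arcs G P')) = pverts G"
      using inv by (auto simp: remove_arcs_def)
    ultimately show ?thesis
      using output_path(1,5) path' len ne last work cut
      by (auto simp: unssp_inv_def intro!: exI[of _ 0])
  qed
qed

lemma unssp_inv_reachable: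
  assumes "unssp_reachable G c lam s t B T \<sigma>" "s \<noteq> t" "s \<in> pverts G"
  shows "unssp_inv G s t T \<sigma>"
proof -
  obtain \<sigma>\<^sub>0 where "unssp_init G c lam s t T \<sigma>\<^sub>0" and "(unssp_step G c lam s t B T)\<^sup>*\<^sup>* \<sigma>\<^sub>0 \<sigma>"
    using assms(1) by (auto simp: unssp_reachable_def)
  from this(2,1) show ?thesis
    by (induction rule: rtranclp_induct) (use assms unssp_inv_init unssp_inv_step in blast)+
qed

end

theorem theorem3p15:
  shows "\<exists>K :: nat. \<forall>(G :: 'v pair_pre_digraph) (c :: 'v \<times> 'v \<Rightarrow> nat) (lam :: nat \<Rightarrow> nat)
           (s :: 'v) (t :: 'v) (\<epsilon> :: real) (B :: real) (T :: nat) (\<sigma> :: 'v unssp_state).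
           pair_fin_digraph G \<and> s \<in> pverts G \<and> t \<in> pverts G \<and> s \<noteq> t
             \<and> simple_paths G s t \<noteq> {}
             \<and> \<epsilon> \<ge> 0 \<and> B = (1 + \<epsilon>) * real (optimal_value G c lam s t)
             \<and> unssp_reachable G c lam s t B T \<sigma>
           \<longrightarrow> (\<forall>w \<in> set (work_per_path \<sigma>). w \<le> K * (card (pverts G) * T))"
  using pair_fin_digraph.unssp_inv_reachable
  by (intro exI[of _ 23]) (fastforce simp: unssp_inv_def)

end
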